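(* Consider the two-stage settlement electricity market described in the context, with total inelastic load $d>0$ split as $d=d^{DA}+d^{RT}$. Efficiency can be realized only when $$\lambda^{DA}=\lambda^{RT}=\lambda ,$$ that is, if the two-stage market realizes efficiency then the day-ahead price, the real-time price and the optimal multiplier of the social cost minimization problem all coincide; and this equality of prices further implies $$d^{DA}=d,\qquad d^{RT}=0 .$$
   Context: Let $\mathcal F$ (fast-responsive generators) and $\mathcal S$ (slow-responsive generators) be nonempty finite sets. Generator $i\in\mathcal F$ has cost $C_i^f(x)=\frac{\alpha_i^f}{2}x^2+\beta_i^f x$ and generator $j\in\mathcal S$ has cost $C_j^s(x)=\frac{\alpha_j^s}{2}x^2+\beta_j^s x$, where $\alpha_i^f>0$, $\alpha_j^s>0$ and $\beta_i^f,\beta_j^s$ are real constants. Generators are non-strategic. Day-ahead market clearing: given $d^{DA}$, let $(x^{f*},x^{s*})$ be the unique minimizer of $$\min_{x^f,x^s\ge 0}\ \sum_{i\in\mathcal F}C_i^f(x_i^f)+\sum_{j\in\mathcal S}C_j^s(x_j^s)\quad\text{s.t.}\quad \sum_{i\in\mathcal F}x_i^f+\sum_{j\in\mathcal S}x_j^s=d^{DA},$$ and let $\lambda^{DA}$ (the day-ahead price) be the optimal Lagrange multiplier of the equality constraint, with the sign convention that it equals the marginal generation cost, i.e. $\lambda^{DA}=\alpha_i^f x_i^{f*}+\beta_i^f=\alpha_j^s x_j^{s*}+\beta_j^s$ for all $i\in\mathcal F,j\in\mathcal S$. Real-time market clearing: given $x^{f*}$ and $d^{RT}$, let $\delta x^{f*}$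 be the unique minimizer of $$\min_{\delta x^f}\ \sum_{i\in\mathcal F}C_i^f(x_i^{f*}+\delta x_i^f)\quad\text{s.t.}\quad\sum_{i\in\mathcal F}\delta x_i^f=d^{RT},$$ and let $\lambda^{RT}$ (the real-time price) be the optimal Lagrange multiplier of the equality constraint, i.e. $\lambda^{RT}=\alpha_i^f(x_i^{f*}+\delta x_i^{f*})+\beta_i^f$ for all $i\in\mathcal F$. Social cost minimization: let $(x^{f\#},x^{s\#})$ be the unique minimizer of $$\min_{x^f,x^s\ge 0}\ \sum_{i\in\mathcal F}C_i^f(x_i^f)+\sum_{j\in\mathcal S}C_j^s(x_j^s)\quad\text{s.t.}\quad \sum_{i\in\mathcal F}x_i^f+\sum_{j\in\mathcal S}x_j^s=d,$$ and let $\lambda$ be the optimal Lagrange multiplier of the equality constraint, i.e. $\lambda=\alpha_i^f x_i^{f\#}+\beta_i^f=\alpha_j^s x_j^{s\#}+\beta_j^s$ for all $i\in\mathcal F,j\in\mathcal S$. Standing assumption: the nonnegativity constraints in the optimization problems above are not binding (so the stated marginal-cost equalities hold at the optima). Efficiency is realized by the two-stage market when its final dispatch attains the minimum social cost for meeting $d$, i.e. when $x_i^{f*}+\delta x_i^{f*}=x_i^{f\#}$ for all $i\in\mathcal F$ and $x_j^{s*}=x_j^{s\#}$ for all $j\in\mathcal S$. *)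

theory Defs
  imports Complex_Main
begin

(* A dispatch assigns an output to every fast generator (index set F) and every slow
   generator (index set S); only the values on F and S are relevant.  Cf i and Cs j are
   the individual cost functions. *)

definition total_cost ::
  "'f set \<Rightarrow> 's set \<Rightarrow> ('f \<Rightarrow> real \<Rightarrow> real) \<Rightarrow> ('s \<Rightarrow> real \<Rightarrow> real) \<Rightarrow>
   ('f \<Rightarrow> real) \<Rightarrow> ('s \<Rightarrow> real) \<Rightarrow> real" where
  "total_cost F S Cf Cs xf xs = (\<Sum>i\<in>F. Cf i (xf i)) + (\<Sum>j\<in>S. Cs j (xs j))"

definition feasible_dispatch ::
  "'f set \<Rightarrow> 's set \<Rightarrow> real \<Rightarrow> ('f \<Rightarrow> real) \<Rightarrow> ('s \<Rightarrow> real) \<Rightarrow> bool" where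
  "feasible_dispatch F S D xf xs \<longleftrightarrow>
     (\<forall>i\<in>F. 0 \<le> xf i) \<and> (\<forall>j\<in>S. 0 \<le> xs j) \<and>
     (\<Sum>i\<in>F. xf i) + (\<Sum>j\<in>S. xs j) = D"

(* Used with the day-ahead demand for the day-ahead market, and with the total demand for
   social cost minimization. *)
definition optimal_dispatch ::
  "'f set \<Rightarrow> 's set \<Rightarrow> ('f \<Rightarrow> real \<Rightarrow> real) \<Rightarrow> ('s \<Rightarrow> real \<Rightarrow> real) \<Rightarrow> real \<Rightarrow>
   ('f \<Rightarrow> real) \<Rightarrow> ('s \<Rightarrow> real) \<Rightarrow> bool" where
  "optimal_dispatch F S Cf Cs D xf xs \<longleftrightarrow>
     feasible_dispatch F S D xf xs \<and>
     (\<forall>yf ys. feasible_dispatch F S D yf ys \<longrightarrow>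
        total_cost F S Cf Cs xf xs \<le> total_cost F S Cf Cs yf ys)"

(* lam belongs to the balance constraint, muf and mus to the nonnegativity constraints.
   The sign of the lam-term makes lam equal to the marginal cost (not its negative). *)
definition dispatch_lagrangian ::
  "'f set \<Rightarrow> 's set \<Rightarrow> ('f \<Rightarrow> real \<Rightarrow> real) \<Rightarrow> ('s \<Rightarrow> real \<Rightarrow> real) \<Rightarrow> real \<Rightarrow>
   real \<Rightarrow> ('f \<Rightarrow> real) \<Rightarrow> ('s \<Rightarrow> real) \<Rightarrow> ('f \<Rightarrow> real) \<Rightarrow> ('s \<Rightarrow> real) \<Rightarrow> real" where
  "dispatch_lagrangian F S Cf Cs D lam muf mus xf xs =
     total_cost F S Cf Cs xf xs
       - lam * ((\<Sum>i\<in>F. xf i) + (\<Sum>j\<in>S. xs j) - D)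
       - (\<Sum>i\<in>F. muf i * xf i) - (\<Sum>j\<in>S. mus j * xs j)"

(* Optimal multipliers at the optimal dispatch (xf, xs): dual feasibility, complementary
   slackness, and minimality of (xf, xs) for the Lagrangian over all real vectors. *)
definition dispatch_multipliers ::
  "'f set \<Rightarrow> 's set \<Rightarrow> ('f \<Rightarrow> real \<Rightarrow> real) \<Rightarrow> ('s \<Rightarrow> real \<Rightarrow> real) \<Rightarrow> real \<Rightarrow>
   ('f \<Rightarrow> real) \<Rightarrow> ('s \<Rightarrow> real) \<Rightarrow> real \<Rightarrow> ('f \<Rightarrow> real) \<Rightarrow> ('s \<Rightarrow> real) \<Rightarrow> bool" where
  "dispatch_multipliers F S Cf Cs D xf xs lam muf mus \<longleftrightarrow>
     (\<forall>i\<in>F. 0 \<le> muf i \<and> muf i * xf i = 0) \<and>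
     (\<forall>j\<in>S. 0 \<le> mus j \<and> mus j * xs j = 0) \<and>
     (\<forall>yf ys. dispatch_lagrangian F S Cf Cs D lam muf mus xf xs
               \<le> dispatch_lagrangian F S Cf Cs D lam muf mus yf ys)"

(* The nonnegativity constraints have zero shadow price.  By complementary slackness this
   covers every strictly positive dispatch; a generator at output 0 whose marginal cost
   equals the price is allowed as well. *)
definition nonneg_not_binding ::
  "'f set \<Rightarrow> 's set \<Rightarrow> ('f \<Rightarrow> real) \<Rightarrow> ('s \<Rightarrow> real) \<Rightarrow> bool" where
  "nonneg_not_binding F S muf mus \<longleftrightarrow> (\<forall>i\<in>F. muf i = 0) \<and> (\<forall>j\<in>S. mus j = 0)"

definition realtime_cost ::
  "'f set \<Rightarrow> ('f \<Rightarrow> real \<Rightarrow> real) \<Rightarrow> ('f \<Rightarrow> real) \<Rightarrow> ('f \<Rightarrow> real) \<Rightarrow> real" where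
  "realtime_cost F Cf xf dx = (\<Sum>i\<in>F. Cf i (xf i + dx i))"

(* The adjustments dx are not sign-constrained. *)
definition optimal_adjustment ::
  "'f set \<Rightarrow> ('f \<Rightarrow> real \<Rightarrow> real) \<Rightarrow> real \<Rightarrow> ('f \<Rightarrow> real) \<Rightarrow> ('f \<Rightarrow> real) \<Rightarrow> bool" where
  "optimal_adjustment F Cf D xf dx \<longleftrightarrow>
     (\<Sum>i\<in>F. dx i) = D \<and>
     (\<forall>dy. (\<Sum>i\<in>F. dy i) = D \<longrightarrow> realtime_cost F Cf xf dx \<le> realtime_cost F Cf xf dy)"

definition realtime_lagrangian ::
  "'f set \<Rightarrow> ('f \<Rightarrow> real \<Rightarrow> real) \<Rightarrow> real \<Rightarrow> ('f \<Rightarrow> real) \<Rightarrow> real \<Rightarrow> ('f \<Rightarrow> real) \<Rightarrow> real" where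
  "realtime_lagrangian F Cf D xf lam dx =
     realtime_cost F Cf xf dx - lam * ((\<Sum>i\<in>F. dx i) - D)"

definition realtime_multiplier ::
  "'f set \<Rightarrow> ('f \<Rightarrow> real \<Rightarrow> real) \<Rightarrow> real \<Rightarrow> ('f \<Rightarrow> real) \<Rightarrow> ('f \<Rightarrow> real) \<Rightarrow> real \<Rightarrow> bool" where
  "realtime_multiplier F Cf D xf dx lam \<longleftrightarrow>
     (\<forall>dy. realtime_lagrangian F Cf D xf lam dx \<le> realtime_lagrangian F Cf D xf lam dy)"

(* (xf, xs) is the day-ahead dispatch, dx the real-time adjustment, (zf, zs) the social
   cost minimizer. *)
definition realizes_efficiency ::
  "'f set \<Rightarrow> 's set \<Rightarrow> ('f \<Rightarrow> real) \<Rightarrow> ('s \<Rightarrow> real) \<Rightarrow> ('f \<Rightarrow> real) \<Rightarrow>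
   ('f \<Rightarrow> real) \<Rightarrow> ('s \<Rightarrow> real) \<Rightarrow> bool" where
  "realizes_efficiency F S xf xs dx zf zs \<longleftrightarrow>
     (\<forall>i\<in>F. xf i + dx i = zf i) \<and> (\<forall>j\<in>S. xs j = zs j)"

end

(* Perturbing a single output in the Lagrangians shows that every multiplier equals the marginal
   costs at the optimum. Efficiency therefore makes the marginal costs of the slow generators equal
   in the day-ahead and the social problem, and those of the fast generators equal in the real-time
   and the social problem. Conversely, equal day-ahead and real-time prices leave the marginal cost
   of each fast generator unchanged; as marginal costs are strictly increasing, no fast generator is
   adjusted. *)

theory Submission
  imports Defs
begin

text \<open>The index-dependent \<open>g\<close> lets one rule serve every sum in the Lagrangians:
  costs, balance and multiplier terms.\<close>

lemma sum_fun_upd: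
  fixes g :: "'a \<Rightarrow> 'b \<Rightarrow> real"
  assumes "finite A" "i \<in> A"
  shows "(\<Sum>k\<in>A. g k ((x(i := t)) k)) = (\<Sum>k\<in>A. g k (x k)) - g i (x i) + g i t"
proof -
  have "(\<Sum>k\<in>A - {i}. g k ((x(i := t)) k)) = (\<Sum>k\<in>A - {i}. g k (x k))"
    by (rule sum.cong) auto
  then show ?thesis
    using assms by (simp add: sum.remove)
qed

text \<open>Fermat's rule for \<open>f t - m * t\<close>: its derivative \<open>D - m\<close>
  vanishes at the global minimizer \<open>x\<close>.\<close>

lemma DERIV_eq_slope_if_min:
  fixes f :: "real \<Rightarrow> real"
  assumes "(f has_real_derivative D) (at x)"
    and "\<And>t. f x - m * x \<le> f t - m * t"
  shows "D = m"
proof -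
  have "((\<lambda>t. f t - m * t) has_real_derivative D - m) (at x)"
    using assms(1) by (auto intro!: derivative_eq_intros)
  from DERIV_local_min[OF this zero_less_one] assms(2) show ?thesis
    by auto
qed

text \<open>With all other outputs fixed, the Lagrangian is
  \<open>Cf i t - (lam + muf i) * t\<close> plus a constant, as a function of the output
  \<open>t\<close> of generator \<open>i\<close>. It is minimized over all real vectors, so
  \<open>t\<close> may be negative or violate the balance; hence \<open>xf i\<close> satisfies the
  first-order condition even when it is 0.\<close>

lemma dispatch_marginal_cost_fast:
  assumes "finite F" "i \<in> F"
    and mult: "dispatch_multipliers F S Cf Cs D xf xs lam muf mus"
    and deriv: "(Cf i has_real_derivative c) (at (xf i))"
  shows "c = lam + muf i"
proof (rule DERIV_eq_slope_if_min[OF deriv])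
  fix t
  have "dispatch_lagrangian F S Cf Cs D lam muf mus xf xs
      \<le> dispatch_lagrangian F S Cf Cs D lam muf mus (xf(i := t)) xs"
    using mult by (auto simp: dispatch_multipliers_def)
  then show "Cf i (xf i) - (lam + muf i) * xf i \<le> Cf i t - (lam + muf i) * t"
    unfolding dispatch_lagrangian_def total_cost_def
      sum_fun_upd[OF assms(1,2), of Cf xf t] sum_fun_upd[OF assms(1,2), of "\<lambda>_ y. y" xf t]
      sum_fun_upd[OF assms(1,2), of "\<lambda>k y. muf k * y" xf t]
    by (simp only: algebra_simps)
qed

lemma dispatch_marginal_cost_slow:
  assumes "finite S" "j \<in> S"
    and mult: "dispatch_multipliers F S Cf Cs D xf xs lam muf mus"
    and deriv: "(Cs j has_real_derivative c) (at (xs j))"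
  shows "c = lam + mus j"
proof (rule DERIV_eq_slope_if_min[OF deriv])
  fix t
  have "dispatch_lagrangian F S Cf Cs D lam muf mus xf xs
      \<le> dispatch_lagrangian F S Cf Cs D lam muf mus xf (xs(j := t))"
    using mult by (auto simp: dispatch_multipliers_def)
  then show "Cs j (xs j) - (lam + mus j) * xs j \<le> Cs j t - (lam + mus j) * t"
    unfolding dispatch_lagrangian_def total_cost_def
      sum_fun_upd[OF assms(1,2), of Cs xs t] sum_fun_upd[OF assms(1,2), of "\<lambda>_ y. y" xs t]
      sum_fun_upd[OF assms(1,2), of "\<lambda>k y. mus k * y" xs t]
    by (simp only: algebra_simps)
qed

lemma realtime_marginal_cost:
  assumes "finite F" "i \<in> F"
    and mult: "realtime_multiplier F Cf D xf dx lam"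
    and deriv: "(Cf i has_real_derivative c) (at (xf i + dx i))"
  shows "c = lam"
proof (rule DERIV_eq_slope_if_min[OF deriv])
  fix t
  \<comment> \<open>The adjustment \<open>t - xf i\<close> makes \<open>t\<close> the final output
    of generator \<open>i\<close>, the variable in which \<open>Cf i\<close> is
    differentiated.\<close>
  have "realtime_lagrangian F Cf D xf lam dx \<le> realtime_lagrangian F Cf D xf lam (dx(i := t - xf i))"
    using mult by (auto simp: realtime_multiplier_def)
  then show "Cf i (xf i + dx i) - lam * (xf i + dx i) \<le> Cf i t - lam * t"
    unfolding realtime_lagrangian_def realtime_cost_def
      sum_fun_upd[OF assms(1,2), of "\<lambda>k y. Cf k (xf k + y)" dx "t - xf i"]
      sum_fun_upd[OF assms(1,2), of "\<lambda>_ y. y" dx "t - xf i"]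
    by (simp only: algebra_simps) simp
qed

lemma quadratic_cost_has_derivative:
  fixes C :: "real \<Rightarrow> real"
  assumes "\<And>x. C x = a / 2 * x^2 + b * x"
  shows "(C has_real_derivative a * x + b) (at x)"
proof -
  have "C = (\<lambda>x. a / 2 * x^2 + b * x)"
    using assms by blast
  then show ?thesis
    by (auto intro!: derivative_eq_intros)
qed

theorem theorem1:
  fixes F :: "'f set" and S :: "'s set"
    and alphaf betaf :: "'f \<Rightarrow> real" and alphas betas :: "'s \<Rightarrow> real"
    and Cf :: "'f \<Rightarrow> real \<Rightarrow> real" and Cs :: "'s \<Rightarrow> real \<Rightarrow> real"
    and d dDA dRT lam lamDA lamRT :: real
    and xf dxf zf mufDA muf :: "'f \<Rightarrow> real" and xs zs musDA mus :: "'s \<Rightarrow> real"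
  assumes "finite F" "F \<noteq> {}" "finite S" "S \<noteq> {}"
    and "\<And>i. i \<in> F \<Longrightarrow> alphaf i > 0" "\<And>j. j \<in> S \<Longrightarrow> alphas j > 0"
    and "\<And>i x. i \<in> F \<Longrightarrow> Cf i x = alphaf i / 2 * x^2 + betaf i * x"
    and "\<And>j x. j \<in> S \<Longrightarrow> Cs j x = alphas j / 2 * x^2 + betas j * x"
    and "d > 0" "d = dDA + dRT"
    and "optimal_dispatch F S Cf Cs dDA xf xs"
    and "dispatch_multipliers F S Cf Cs dDA xf xs lamDA mufDA musDA"
    and "nonneg_not_binding F S mufDA musDA"
    and "optimal_adjustment F Cf dRT xf dxf"
    and "realtime_multiplier F Cf dRT xf dxf lamRT"
    and "optimal_dispatch F S Cf Cs d zf zs"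
    and "dispatch_multipliers F S Cf Cs d zf zs lam muf mus"
    and "nonneg_not_binding F S muf mus"
  shows "(realizes_efficiency F S xf xs dxf zf zs \<longrightarrow> lamDA = lamRT \<and> lamRT = lam) \<and>
         (lamDA = lamRT \<and> lamRT = lam \<longrightarrow> dDA = d \<and> dRT = 0)"
proof -
  have Cf': "(Cf i has_real_derivative alphaf i * x + betaf i) (at x)" if "i \<in> F" for i x
    using assms(7) that by (intro quadratic_cost_has_derivative) simp
  have Cs': "(Cs j has_real_derivative alphas j * x + betas j) (at x)" if "j \<in> S" for j x
    using assms(8) that by (intro quadratic_cost_has_derivative) simp
  have mu0: "mufDA i = 0" "muf i = 0" "musDA j = 0" "mus j = 0" if "i \<in> F" "j \<in> S" for i j
    using assms(13,18) that by (auto simp: nonneg_not_binding_def)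
  \<comment> \<open>One generator of each type is enough to compare prices: \<open>i0\<close> links
    real time to the social problem, \<open>j0\<close> links day-ahead to it.\<close>
  obtain i0 j0 where i0: "i0 \<in> F" and j0: "j0 \<in> S"
    using assms(2,4) by blast
  \<comment> \<open>This equation and the next are kept for every fast generator, since the second
    implication needs all adjustments to vanish.\<close>
  have DA_fast: "alphaf i * xf i + betaf i = lamDA" if "i \<in> F" for i
    using dispatch_marginal_cost_fast[OF assms(1) that assms(12) Cf'[OF that]] mu0[OF that j0] by simp
  have RT_fast: "alphaf i * (xf i + dxf i) + betaf i = lamRT" if "i \<in> F" for i
    using realtime_marginal_cost[OF assms(1) that assms(15) Cf'[OF that]] .
  have DA_slow: "alphas j0 * xs j0 + betas j0 = lamDA"
    using dispatch_marginal_cost_slow[OF assms(3) j0 assms(12) Cs'[OF j0]] mu0[OF i0 j0] by simp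
  have social_fast: "alphaf i0 * zf i0 + betaf i0 = lam"
    using dispatch_marginal_cost_fast[OF assms(1) i0 assms(17) Cf'[OF i0]] mu0[OF i0 j0] by simp
  have social_slow: "alphas j0 * zs j0 + betas j0 = lam"
    using dispatch_marginal_cost_slow[OF assms(3) j0 assms(17) Cs'[OF j0]] mu0[OF i0 j0] by simp
  show ?thesis
  proof (intro conjI impI)
    assume "realizes_efficiency F S xf xs dxf zf zs"
    then have "xf i0 + dxf i0 = zf i0" "xs j0 = zs j0"
      using i0 j0 by (auto simp: realizes_efficiency_def)
    \<comment> \<open>Slow output is final after the day-ahead stage, so
      \<open>xs j0 = zs j0\<close> forces \<open>lamDA = lam\<close>; the final output of
      \<open>i0\<close> forces \<open>lamRT = lam\<close>.\<close>
    then show "lamDA = lamRT" "lamRT = lam"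
      using RT_fast[OF i0] DA_slow social_fast social_slow by auto
  next
    assume prices: "lamDA = lamRT \<and> lamRT = lam"
    have "dxf i = 0" if "i \<in> F" for i
    proof -
      \<comment> \<open>The difference of the two marginal-cost equations, in which
        \<open>betaf i\<close> and the day-ahead output cancel.\<close>
      have "alphaf i * dxf i = 0"
        using DA_fast[OF that] RT_fast[OF that] prices by (simp only: distrib_left)
      then show ?thesis
        using assms(5)[OF that] by simp
    qed
    \<comment> \<open>By the real-time balance, \<open>dRT\<close> is the sum of the
      adjustments.\<close>
    then show "dRT = 0"
      using assms(14) by (simp add: optimal_adjustment_def)
    then show "dDA = d"
      using assms(10) by simp
  qed
qed

end
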